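(* Let $\lambda$ be a $\sigma$-finite measure on $(\mathbb{R},\mathcal{B}(\mathbb{R}))$ and let $a:\mathbb{R}\to\mathbb{R}$ be the density with respect to $\lambda$ of a finite positive measure on $(\mathbb{R},\mathcal{B}(\mathbb{R}))$, such that (1) $a(x)>0$ for all $x\in\mathbb{R}$; (2) there exists $\delta>0$ such that for all $s\in[-\delta,\delta]$, $$M(s;a)=\int_{\mathbb{R}} e^{sx}a(x)\,\lambda(dx)<\infty .$$ Let $\{e_i\}_{i\in\mathbb{N}_0}\subseteq L^2(a)$ be the orthonormal sequence of polynomials obtained by applying the Gram-Schmidt orthonormalization process in $L^2(a)$ to the sequence of monomials $1,x,x^2,\dots$. Then $\{e_i\}_{i\in\mathbb{N}_0}$ is complete in $L^2(a)$.
   Context: $\mathbb{N}_0=\{0,1,2,\dots\}$ and $\mathcal{B}(\mathbb{R})$ is the Borel $\sigma$-algebra. $L^2(a)$ denotes the Hilbert space of (classes of) real-valued Borel functions on $\mathbb{R}$ that are square integrable with respect to the measure $a(x)\,\lambda(dx)$, with inner product $\langle f,g\rangle_a=\int_{\mathbb{R}} f(x)g(x)a(x)\,\lambda(dx)$ and the associated norm $\|\cdot\|_a$. An orthonormal sequence is complete in $L^2(a)$ if its closed linear span is all of $L^2(a)$ (equivalently, the only element of $L^2(a)$ orthogonal to every member of the sequence is $0$). Completeness of $\{e_i\}$ thus means that the polynomials are dense in $L^2(a)$. Hypothesis (2) guarantees that all monomials lie in $L^2(a)$. In the Gram-Schmidt process, a monomial that is linearly dependent in $L^2(a)$ on the preceding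 ones is omitted (in which case the resulting orthonormal family may be finite). *)

theory Defs
  imports "HOL-Analysis.Analysis"
begin

text \<open>
  Throughout, \<open>\<nu>\<close> is the reference measure on the real line and \<open>a\<close> the weight. The elements of
  \<open>L\<^sup>2(a)\<close> are represented by functions; equality in \<open>L\<^sup>2(a)\<close> is equality almost everywhere with
  respect to \<open>a(x) \<nu>(dx)\<close>.
\<close>

definition weighted_measure :: "real measure \<Rightarrow> (real \<Rightarrow> real) \<Rightarrow> real measure" where
  "weighted_measure \<nu> a = density \<nu> (\<lambda>x. ennreal (a x))"

definition weighted_L2 :: "real measure \<Rightarrow> (real \<Rightarrow> real) \<Rightarrow> (real \<Rightarrow> real) set" where
  "weighted_L2 \<nu> a =
     {f. f \<in> borel_measurable borel \<and> integrable (weighted_measure \<nu> a) (\<lambda>x. (f x)\<^sup>2)}"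

definition weighted_inner ::
    "real measure \<Rightarrow> (real \<Rightarrow> real) \<Rightarrow> (real \<Rightarrow> real) \<Rightarrow> (real \<Rightarrow> real) \<Rightarrow> real" where
  "weighted_inner \<nu> a f g = (\<integral>x. f x * g x * a x \<partial>\<nu>)"

definition weighted_norm :: "real measure \<Rightarrow> (real \<Rightarrow> real) \<Rightarrow> (real \<Rightarrow> real) \<Rightarrow> real" where
  "weighted_norm \<nu> a f = sqrt (weighted_inner \<nu> a f f)"

definition moment_gen :: "real measure \<Rightarrow> (real \<Rightarrow> real) \<Rightarrow> real \<Rightarrow> ennreal" where
  "moment_gen \<nu> a s = (\<integral>\<^sup>+x. ennreal (exp (s * x) * a x) \<partial>\<nu>)"

definition monomial_dependent :: "real measure \<Rightarrow> (real \<Rightarrow> real) \<Rightarrow> nat \<Rightarrow> bool" where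
  "monomial_dependent \<nu> a n \<longleftrightarrow>
     (\<exists>c :: nat \<Rightarrow> real. AE x in weighted_measure \<nu> a. x ^ n = (\<Sum>k<n. c k * x ^ k))"

text \<open>
  Gram-Schmidt applied to the monomials. The orthonormal polynomials are indexed by the exponents
  of the monomials that are not omitted; if no monomial is omitted, the index set is all of the
  natural numbers. The values of \<open>gs_poly\<close> at omitted exponents are irrelevant.
\<close>

definition gs_index :: "real measure \<Rightarrow> (real \<Rightarrow> real) \<Rightarrow> nat set" where
  "gs_index \<nu> a = {n. \<not> monomial_dependent \<nu> a n}"

function gs_poly :: "real measure \<Rightarrow> (real \<Rightarrow> real) \<Rightarrow> nat \<Rightarrow> real \<Rightarrow> real" where
  "gs_poly \<nu> a n =
     (let r = (\<lambda>x. x ^ n - (\<Sum>k \<in> {k \<in> gs_index \<nu> a. k < n}.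
                  weighted_inner \<nu> a (\<lambda>y. y ^ n) (gs_poly \<nu> a k) * gs_poly \<nu> a k x))
      in (\<lambda>x. r x / weighted_norm \<nu> a r))"
  by pat_completeness auto
termination
  by (relation "Wellfounded.measure (\<lambda>(\<nu>, a, n). n)") auto

declare gs_poly.simps [simp del]

definition orthonormal_family ::
    "real measure \<Rightarrow> (real \<Rightarrow> real) \<Rightarrow> 'i set \<Rightarrow> ('i \<Rightarrow> real \<Rightarrow> real) \<Rightarrow> bool" where
  "orthonormal_family \<nu> a I e \<longleftrightarrow>
     (\<forall>i\<in>I. e i \<in> weighted_L2 \<nu> a) \<and>
     (\<forall>i\<in>I. \<forall>j\<in>I. weighted_inner \<nu> a (e i) (e j) = (if i = j then 1 else 0))"

definition family_span :: "'i set \<Rightarrow> ('i \<Rightarrow> real \<Rightarrow> real) \<Rightarrow> (real \<Rightarrow> real) set" where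
  "family_span I e = {(\<lambda>x. \<Sum>i\<in>F. c i * e i x) | F c. finite F \<and> F \<subseteq> I}"

definition closed_family_span ::
    "real measure \<Rightarrow> (real \<Rightarrow> real) \<Rightarrow> 'i set \<Rightarrow> ('i \<Rightarrow> real \<Rightarrow> real) \<Rightarrow> (real \<Rightarrow> real) set" where
  "closed_family_span \<nu> a I e =
     {f \<in> weighted_L2 \<nu> a. \<forall>\<epsilon>>0. \<exists>g \<in> family_span I e. weighted_norm \<nu> a (\<lambda>x. f x - g x) < \<epsilon>}"

text \<open>
  The requirement that the family is orthonormal (in particular contained in \<open>L\<^sup>2(a)\<close>) also rules
  out the junk value 0 that the Bochner integral takes for non-integrable functions.
\<close>

definition complete_orthonormal ::
    "real measure \<Rightarrow> (real \<Rightarrow> real) \<Rightarrow> 'i set \<Rightarrow> ('i \<Rightarrow> real \<Rightarrow> real) \<Rightarrow> bool" where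
  "complete_orthonormal \<nu> a I e \<longleftrightarrow>
     orthonormal_family \<nu> a I e \<and> closed_family_span \<nu> a I e = weighted_L2 \<nu> a"

end

theory Submission
  imports Defs "HOL-Computational_Algebra.Polynomial"
begin

text \<open>
  Let \<open>H\<close> be the closure of the polynomials in mean square. The bounded functions \<open>g\<close> with
  \<open>g H \<subseteq> H\<close> (the multipliers of \<open>H\<close>) form an algebra that is closed under bounded pointwise limits,
  so the sets whose indicators are multipliers form a \<open>\<sigma>\<close>-algebra. By the exponential moments, the
  Taylor series of \<open>sin (t x)\<close> shows that this function is a multiplier for small \<open>t\<close>; since
  \<open>sin (t x) / t\<close> tends to \<open>x\<close> as \<open>t\<close> tends to 0, the \<open>\<sigma>\<close>-algebra contains all Borel sets.
  As \<open>1 \<in> H\<close>, all simple functions lie in \<open>H\<close>, and these are dense.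
\<close>

section \<open>Closed subspaces of square integrable functions and their multipliers\<close>

definition sq_integrable :: "'a measure \<Rightarrow> ('a \<Rightarrow> real) set" where
  "sq_integrable M = {f \<in> borel_measurable M. integrable M (\<lambda>x. (f x)\<^sup>2)}"

text \<open>Distances are measured by the squared norm. For \<open>V\<close> inside
  \<open>sq_integrable M\<close>, as in the locale \<open>l2_subspace\<close>, the integrand is
  integrable, so the default value 0 of the Bochner integral cannot fake a small distance.\<close>

definition l2_closure :: "'a measure \<Rightarrow> ('a \<Rightarrow> real) set \<Rightarrow> ('a \<Rightarrow> real) set" where
  "l2_closure M V =
     {f \<in> sq_integrable M. \<forall>\<epsilon>>0. \<exists>g\<in>V. (\<integral>x. (f x - g x)\<^sup>2 \<partial>M) < \<epsilon>}"

lemma sq_integrable_measurable: "f \<in> sq_integrable M \<Longrightarrow> f \<in> borel_measurable M"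
  by (simp add: sq_integrable_def)

lemma sq_integrable_square: "f \<in> sq_integrable M \<Longrightarrow> integrable M (\<lambda>x. (f x)\<^sup>2)"
  by (simp add: sq_integrable_def)

lemma sq_integrable_bound:
  assumes "w \<in> sq_integrable M" "f \<in> borel_measurable M" "\<And>x. \<bar>f x\<bar> \<le> \<bar>w x\<bar>"
  shows "f \<in> sq_integrable M"
proof -
  have "integrable M (\<lambda>x. (f x)\<^sup>2)"
    by (rule Bochner_Integration.integrable_bound[OF sq_integrable_square[OF assms(1)]])
       (use assms in \<open>auto simp: abs_le_square_iff\<close>)
  then show ?thesis using assms by (simp add: sq_integrable_def)
qed

lemma sq_integrable_cong_AE:
  assumes "f \<in> sq_integrable M" "g \<in> borel_measurable M" "AE x in M. f x = g x"
  shows "g \<in> sq_integrable M"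
proof -
  have "integrable M (\<lambda>x. (g x)\<^sup>2)"
    by (rule integrable_cong_AE_imp[OF sq_integrable_square[OF assms(1)]]) (use assms in auto)
  then show ?thesis using assms by (simp add: sq_integrable_def)
qed

lemma sq_integrable_mult:
  assumes "f \<in> sq_integrable M" "g \<in> sq_integrable M"
  shows "integrable M (\<lambda>x. f x * g x)"
proof -
  \<comment> \<open>A cheap form of the arithmetic-geometric mean inequality: the product is
    dominated by the sum of the two squares.\<close>
  have *: "\<bar>u * v\<bar> \<le> u\<^sup>2 + v\<^sup>2" for u v :: real
  proof -
    have "0 \<le> (\<bar>u\<bar> - \<bar>v\<bar>)\<^sup>2" by simp
    moreover have "\<dots> = u\<^sup>2 + v\<^sup>2 - 2 * \<bar>u * v\<bar>" by (simp add: power2_diff abs_mult)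
    ultimately show ?thesis using abs_ge_zero[of "u * v"] by linarith
  qed
  show ?thesis
    by (rule Bochner_Integration.integrable_bound[where f = "\<lambda>x. (f x)\<^sup>2 + (g x)\<^sup>2"])
       (use assms * in \<open>auto simp: sq_integrable_def\<close>)
qed

lemma sq_integrable_add:
  assumes "f \<in> sq_integrable M" "g \<in> sq_integrable M"
  shows "(\<lambda>x. f x + g x) \<in> sq_integrable M"
  using assms sq_integrable_mult[OF assms]
  by (auto simp: sq_integrable_def power2_sum mult.assoc)

lemma sq_integrable_scale:
  "f \<in> sq_integrable M \<Longrightarrow> (\<lambda>x. c * f x) \<in> sq_integrable M"
  by (auto simp: sq_integrable_def power_mult_distrib)

lemma sq_integrable_diff:
  assumes "f \<in> sq_integrable M" "g \<in> sq_integrable M"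
  shows "(\<lambda>x. f x - g x) \<in> sq_integrable M"
  using sq_integrable_add[OF assms(1) sq_integrable_scale[OF assms(2), of "-1"]] by simp

lemma sq_integrable_sum:
  assumes "\<And>i. i \<in> F \<Longrightarrow> f i \<in> sq_integrable M"
  shows "(\<lambda>x. \<Sum>i\<in>F. f i x) \<in> sq_integrable M"
  using assms
proof (induction F rule: infinite_finite_induct)
  case (insert i F)
  then show ?case using sq_integrable_add[of "f i" M "\<lambda>x. \<Sum>i\<in>F. f i x"] by simp
qed (simp_all add: sq_integrable_def)

text \<open>Plays the role of the triangle inequality for squared distances. The factor 2 is the
  reason why approximations below are taken within \<open>\<epsilon> / 4\<close>.\<close>

lemma integral_square_add_le:
  assumes "u \<in> sq_integrable M" "v \<in> sq_integrable M"
  shows "(\<integral>x. (u x + v x)\<^sup>2 \<partial>M) \<le> 2 * (\<integral>x. (u x)\<^sup>2 \<partial>M) + 2 * (\<integral>x. (v x)\<^sup>2 \<partial>M)"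
proof -
  have "(\<integral>x. (u x + v x)\<^sup>2 \<partial>M) \<le> (\<integral>x. 2 * (u x)\<^sup>2 + 2 * (v x)\<^sup>2 \<partial>M)"
  proof (rule integral_mono)
    show "integrable M (\<lambda>x. (u x + v x)\<^sup>2)"
      using sq_integrable_square[OF sq_integrable_add[OF assms]] .
    show "integrable M (\<lambda>x. 2 * (u x)\<^sup>2 + 2 * (v x)\<^sup>2)"
      using assms by (simp add: sq_integrable_square)
    show "(u x + v x)\<^sup>2 \<le> 2 * (u x)\<^sup>2 + 2 * (v x)\<^sup>2" for x
      using zero_le_power2[of "u x - v x"] by (simp add: power2_sum power2_diff)
  qed
  also have "\<dots> = 2 * (\<integral>x. (u x)\<^sup>2 \<partial>M) + 2 * (\<integral>x. (v x)\<^sup>2 \<partial>M)"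
    using assms by (simp add: sq_integrable_square)
  finally show ?thesis .
qed

section \<open>Linear subspaces and their closure in mean square\<close>

locale l2_subspace =
  fixes M :: "'a measure" and V :: "('a \<Rightarrow> real) set"
  assumes subset: "V \<subseteq> sq_integrable M"
    and zero: "(\<lambda>x. 0) \<in> V"
    and add: "f \<in> V \<Longrightarrow> g \<in> V \<Longrightarrow> (\<lambda>x. f x + g x) \<in> V"
    and scale: "f \<in> V \<Longrightarrow> (\<lambda>x. c * f x) \<in> V"
begin

lemma closure_subset: "l2_closure M V \<subseteq> sq_integrable M"
  by (auto simp: l2_closure_def)

lemma subset_closure: "V \<subseteq> l2_closure M V"
  using subset by (force simp: l2_closure_def)

lemma closureD:
  assumes "f \<in> l2_closure M V" "\<epsilon> > 0"
  obtains p where "p \<in> V" "(\<integral>x. (f x - p x)\<^sup>2 \<partial>M) < \<epsilon>"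
  using assms unfolding l2_closure_def by blast

text \<open>Idempotence of the closure: an approximant from the closure is itself approximated from
  \<open>V\<close>, and the two errors add up.\<close>

lemma closure_approx:
  assumes f: "f \<in> sq_integrable M"
    and approx: "\<And>\<epsilon>. \<epsilon> > 0 \<Longrightarrow> \<exists>g\<in>l2_closure M V. (\<integral>x. (f x - g x)\<^sup>2 \<partial>M) < \<epsilon>"
  shows "f \<in> l2_closure M V"
proof -
  have "\<exists>p\<in>V. (\<integral>x. (f x - p x)\<^sup>2 \<partial>M) < \<epsilon>" if \<epsilon>: "\<epsilon> > 0" for \<epsilon>
  proof -
    obtain g where g: "g \<in> l2_closure M V" "(\<integral>x. (f x - g x)\<^sup>2 \<partial>M) < \<epsilon> / 4"
      using approx[of "\<epsilon> / 4"] \<epsilon> by auto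
    obtain p where p: "p \<in> V" "(\<integral>x. (g x - p x)\<^sup>2 \<partial>M) < \<epsilon> / 4"
      by (rule closureD[OF g(1), of "\<epsilon> / 4"]) (use \<epsilon> in auto)
    have "g \<in> sq_integrable M" "p \<in> sq_integrable M" using g p closure_subset subset by auto
    from integral_square_add_le[OF sq_integrable_diff[OF f this(1)] sq_integrable_diff[OF this]]
    have "(\<integral>x. (f x - p x)\<^sup>2 \<partial>M) < \<epsilon>" using g(2) p(2) by simp
    with p show ?thesis by auto
  qed
  with f show ?thesis by (simp add: l2_closure_def)
qed

lemma closure_add:
  assumes "f \<in> l2_closure M V" "g \<in> l2_closure M V"
  shows "(\<lambda>x. f x + g x) \<in> l2_closure M V"
proof -
  have fg: "f \<in> sq_integrable M" "g \<in> sq_integrable M" using assms closure_subset by auto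
  have "\<exists>h\<in>V. (\<integral>x. (f x + g x - h x)\<^sup>2 \<partial>M) < \<epsilon>" if \<epsilon>: "\<epsilon> > 0" for \<epsilon>
  proof -
    obtain p where p: "p \<in> V" "(\<integral>x. (f x - p x)\<^sup>2 \<partial>M) < \<epsilon> / 4"
      by (rule closureD[OF assms(1), of "\<epsilon> / 4"]) (use \<epsilon> in auto)
    obtain q where q: "q \<in> V" "(\<integral>x. (g x - q x)\<^sup>2 \<partial>M) < \<epsilon> / 4"
      by (rule closureD[OF assms(2), of "\<epsilon> / 4"]) (use \<epsilon> in auto)
    have "p \<in> sq_integrable M" "q \<in> sq_integrable M" using p q subset by auto
    from integral_square_add_le[OF sq_integrable_diff[OF fg(1) this(1)]
        sq_integrable_diff[OF fg(2) this(2)]]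
    have "(\<integral>x. (f x + g x - (p x + q x))\<^sup>2 \<partial>M) < \<epsilon>"
      using p(2) q(2) by (simp add: algebra_simps)
    with add[OF p(1) q(1)] show ?thesis by (intro bexI[of _ "\<lambda>x. p x + q x"]) auto
  qed
  with sq_integrable_add[OF fg] show ?thesis by (simp add: l2_closure_def)
qed

lemma closure_scale:
  assumes "f \<in> l2_closure M V"
  shows "(\<lambda>x. c * f x) \<in> l2_closure M V"
proof -
  have "\<exists>h\<in>V. (\<integral>x. (c * f x - h x)\<^sup>2 \<partial>M) < \<epsilon>" if \<epsilon>: "\<epsilon> > 0" for \<epsilon>
  proof -
    \<comment> \<open>The summand 1 keeps the divisor positive when \<open>c\<close> is 0.\<close>
    have "\<epsilon> / (c\<^sup>2 + 1) > 0" using \<epsilon> by (simp add: add_nonneg_pos)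
    then obtain p where p: "p \<in> V" "(\<integral>x. (f x - p x)\<^sup>2 \<partial>M) < \<epsilon> / (c\<^sup>2 + 1)"
      using assms by (auto simp: l2_closure_def)
    have "(\<integral>x. (c * f x - c * p x)\<^sup>2 \<partial>M) = c\<^sup>2 * (\<integral>x. (f x - p x)\<^sup>2 \<partial>M)"
      by (simp add: right_diff_distrib[symmetric] power_mult_distrib)
    also have "\<dots> \<le> (c\<^sup>2 + 1) * (\<integral>x. (f x - p x)\<^sup>2 \<partial>M)"
      by (intro mult_right_mono) auto
    also have "\<dots> < \<epsilon>"
      using p(2) by (simp add: pos_less_divide_eq add_nonneg_pos mult.commute)
    finally show ?thesis using scale[OF p(1)] by (intro bexI[of _ "\<lambda>x. c * p x"]) auto
  qed
  with assms closure_subset sq_integrable_scale show ?thesis by (auto simp: l2_closure_def)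
qed

lemma closure_sum:
  assumes "\<And>i. i \<in> F \<Longrightarrow> f i \<in> l2_closure M V"
  shows "(\<lambda>x. \<Sum>i\<in>F. f i x) \<in> l2_closure M V"
  using assms
proof (induction F rule: infinite_finite_induct)
  case (insert i F)
  then show ?case using closure_add[of "f i" "\<lambda>x. \<Sum>i\<in>F. f i x"] by simp
qed (use zero subset_closure in auto)

text \<open>The function \<open>f\<close> approximates \<open>g\<close> with squared distance 0.
  This serves the omitted monomials, which are combinations of earlier ones only almost
  everywhere.\<close>

lemma closure_cong_AE:
  assumes f: "f \<in> l2_closure M V" and g: "g \<in> borel_measurable M" and eq: "AE x in M. f x = g x"
  shows "g \<in> l2_closure M V"
proof (rule closure_approx)
  have f': "f \<in> sq_integrable M" using f closure_subset by auto
  show "g \<in> sq_integrable M" by (rule sq_integrable_cong_AE[OF f' g eq])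
  have "(\<integral>x. (g x - f x)\<^sup>2 \<partial>M) = (\<integral>x. 0 \<partial>M)"
    by (rule integral_cong_AE) (use eq g sq_integrable_measurable[OF f'] in auto)
  then show "\<exists>h\<in>l2_closure M V. (\<integral>x. (g x - h x)\<^sup>2 \<partial>M) < \<epsilon>" if "\<epsilon> > 0" for \<epsilon>
    using f that by (intro bexI[of _ f]) auto
qed

text \<open>Dominated convergence: \<open>s n\<close> and the limit \<open>f\<close> are both
  bounded by \<open>\<bar>w x\<bar>\<close>, so four times the square of \<open>w\<close> dominates
  the squared errors, and their integrals tend to 0.\<close>

lemma closure_limit:
  assumes s: "\<And>n. s n \<in> l2_closure M V" and w: "w \<in> sq_integrable M"
    and bound: "\<And>n x. \<bar>s n x\<bar> \<le> \<bar>w x\<bar>" and lim: "\<And>x. (\<lambda>n. s n x) \<longlonglongrightarrow> f x"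
  shows "f \<in> l2_closure M V"
proof (rule closure_approx)
  have s': "s n \<in> borel_measurable M" for n
    using s closure_subset sq_integrable_measurable by blast
  have f': "f \<in> borel_measurable M"
    by (rule borel_measurable_LIMSEQ_real[where u = s]) (use lim s' in auto)
  have fw: "\<bar>f x\<bar> \<le> \<bar>w x\<bar>" for x
    using bound by (intro LIMSEQ_le_const2[OF tendsto_rabs[OF lim]]) auto
  show "f \<in> sq_integrable M"
    by (rule sq_integrable_bound[OF w f' fw])
  have "(\<lambda>n. \<integral>x. (f x - s n x)\<^sup>2 \<partial>M) \<longlonglongrightarrow> (\<integral>x. 0 \<partial>M)"
  proof (rule integral_dominated_convergence)
    show "integrable M (\<lambda>x. 4 * (w x)\<^sup>2)" using sq_integrable_square[OF w] by simp
    have "(\<lambda>n. (f x - s n x)\<^sup>2) \<longlonglongrightarrow> (f x - f x)\<^sup>2" for x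
      by (intro tendsto_intros lim)
    then show "AE x in M. (\<lambda>n. (f x - s n x)\<^sup>2) \<longlonglongrightarrow> 0" by simp
    have "(f x - s n x)\<^sup>2 \<le> (2 * w x)\<^sup>2" for n x
      using fw[of x] bound[of n x] by (subst abs_le_square_iff[symmetric]) (simp add: abs_mult)
    then show "AE x in M. norm ((f x - s n x)\<^sup>2) \<le> 4 * (w x)\<^sup>2" for n
      by (simp add: power_mult_distrib)
  qed (use f' s' in measurable)
  then have lim0: "(\<lambda>n. \<integral>x. (f x - s n x)\<^sup>2 \<partial>M) \<longlonglongrightarrow> 0" by simp
  show "\<exists>g\<in>l2_closure M V. (\<integral>x. (f x - g x)\<^sup>2 \<partial>M) < \<epsilon>" if "\<epsilon> > 0" for \<epsilon>
    using eventually_happens[OF order_tendstoD(2)[OF lim0 that]] s by auto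
qed

section \<open>The algebra of bounded multipliers\<close>

definition multiplier :: "('a \<Rightarrow> real) \<Rightarrow> bool" where
  "multiplier g \<longleftrightarrow> g \<in> borel_measurable M \<and> (\<exists>C. \<forall>x. \<bar>g x\<bar> \<le> C) \<and>
     (\<forall>f\<in>l2_closure M V. (\<lambda>x. g x * f x) \<in> l2_closure M V)"

lemma multiplierD: "multiplier g \<Longrightarrow> f \<in> l2_closure M V \<Longrightarrow> (\<lambda>x. g x * f x) \<in> l2_closure M V"
  by (simp add: multiplier_def)

lemma multiplier_const: "multiplier (\<lambda>x. c)"
  by (auto simp: multiplier_def closure_scale)

lemma multiplier_add:
  assumes "multiplier g" "multiplier h"
  shows "multiplier (\<lambda>x. g x + h x)"
proof -
  obtain C D where "\<And>x. \<bar>g x\<bar> \<le> C" "\<And>x. \<bar>h x\<bar> \<le> D" using assms by (auto simp: multiplier_def)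
  then have "\<forall>x. \<bar>g x + h x\<bar> \<le> C + D" by (meson abs_triangle_ineq add_mono order_trans)
  with assms show ?thesis
    by (auto simp: multiplier_def distrib_right intro: closure_add)
qed

text \<open>Multipliers act on the closure itself and not merely on \<open>V\<close>, so two of them
  can be applied one after the other.\<close>

lemma multiplier_mult:
  assumes "multiplier g" "multiplier h"
  shows "multiplier (\<lambda>x. g x * h x)"
proof -
  obtain C D where CD: "\<And>x. \<bar>g x\<bar> \<le> C" "\<And>x. \<bar>h x\<bar> \<le> D"
    using assms by (auto simp: multiplier_def)
  have "\<bar>g x * h x\<bar> \<le> C * D" for x
    unfolding abs_mult by (rule mult_mono[OF CD order_trans[OF abs_ge_zero CD(1)] abs_ge_zero])
  with assms show ?thesis
    by (auto simp: multiplier_def mult.assoc)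
qed

lemma multiplier_diff: "multiplier g \<Longrightarrow> multiplier h \<Longrightarrow> multiplier (\<lambda>x. g x - h x)"
  using multiplier_add[of g "\<lambda>x. - 1 * h x"] multiplier_mult[OF multiplier_const[of "-1"]] by simp

lemma multiplier_polynomial:
  assumes "real_polynomial_function p" "multiplier g"
  shows "multiplier (\<lambda>x. p (g x))"
  using assms(1)
proof induction
  case (linear f)
  \<comment> \<open>A bounded linear map on the reals is multiplication by a constant.\<close>
  then obtain c where "f = (\<lambda>x. x * c)" using real_bounded_linear by auto
  then show ?case using multiplier_mult[OF assms(2) multiplier_const] by simp
qed (use multiplier_const multiplier_add multiplier_mult in auto)

text \<open>For \<open>f\<close> in the closure the products \<open>G n x * f x\<close> are
  dominated by \<open>C * f x\<close>, so \<open>closure_limit\<close> applies to them.\<close>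

lemma multiplier_limit:
  assumes "\<And>n. multiplier (G n)" "\<And>n x. \<bar>G n x\<bar> \<le> C" and lim: "\<And>x. (\<lambda>n. G n x) \<longlonglongrightarrow> g x"
  shows "multiplier g"
  unfolding multiplier_def
proof (intro conjI exI allI ballI)
  show "g \<in> borel_measurable M"
    by (rule borel_measurable_LIMSEQ_real[where u = G])
       (use assms in \<open>auto simp: multiplier_def\<close>)
  show "\<bar>g x\<bar> \<le> C" for x
    using assms(2) by (intro LIMSEQ_le_const2[OF tendsto_rabs[OF lim]]) auto
  fix f assume f: "f \<in> l2_closure M V"
  show "(\<lambda>x. g x * f x) \<in> l2_closure M V"
  proof (rule closure_limit)
    show "(\<lambda>x. G n x * f x) \<in> l2_closure M V" for n using assms(1) f by (rule multiplierD)
    show "(\<lambda>x. C * f x) \<in> sq_integrable M" using f closure_subset sq_integrable_scale by blast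
    have "\<bar>G n x\<bar> \<le> \<bar>C\<bar>" for n x using assms(2)[of n x] by linarith
    then show "\<bar>G n x * f x\<bar> \<le> \<bar>C * f x\<bar>" for n x
      by (auto simp: abs_mult intro: mult_right_mono)
    show "(\<lambda>n. G n x * f x) \<longlonglongrightarrow> g x * f x" for x by (intro tendsto_intros lim)
  qed
qed

text \<open>Multiplication by a function bounded by \<open>C\<close> increases squared distances at
  most by the factor \<open>C\<^sup>2\<close>. By this continuity it suffices to test products with
  elements of \<open>V\<close>.\<close>

lemma multiplierI:
  assumes g: "g \<in> borel_measurable M" and bound: "\<And>x. \<bar>g x\<bar> \<le> C"
    and V: "\<And>p. p \<in> V \<Longrightarrow> (\<lambda>x. g x * p x) \<in> l2_closure M V"
  shows "multiplier g"
  unfolding multiplier_def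
proof (intro conjI exI allI ballI)
  fix f assume f: "f \<in> l2_closure M V"
  have f': "f \<in> sq_integrable M" using f closure_subset by auto
  have bd: "\<bar>g x * u\<bar> \<le> \<bar>C * u\<bar>" for x u
    using bound[of x] by (auto simp: abs_mult intro!: mult_right_mono)
  have sq: "(\<lambda>x. g x * h x) \<in> sq_integrable M" if "h \<in> sq_integrable M" for h
    by (rule sq_integrable_bound[OF sq_integrable_scale[OF that, of C]])
       (use bd g sq_integrable_measurable[OF that] in auto)
  show "(\<lambda>x. g x * f x) \<in> l2_closure M V"
  proof (rule closure_approx)
    show "(\<lambda>x. g x * f x) \<in> sq_integrable M" by (rule sq[OF f'])
    fix \<epsilon> :: real assume "\<epsilon> > 0"
    then have "\<epsilon> / (C\<^sup>2 + 1) > 0" by (simp add: add_nonneg_pos)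
    then obtain p where p: "p \<in> V" "(\<integral>x. (f x - p x)\<^sup>2 \<partial>M) < \<epsilon> / (C\<^sup>2 + 1)"
      using f by (auto simp: l2_closure_def)
    have fp: "(\<lambda>x. f x - p x) \<in> sq_integrable M"
      using sq_integrable_diff[OF f'] p(1) subset by auto
    have "(\<integral>x. (g x * f x - g x * p x)\<^sup>2 \<partial>M) \<le> (\<integral>x. C\<^sup>2 * (f x - p x)\<^sup>2 \<partial>M)"
    proof (rule integral_mono)
      show "integrable M (\<lambda>x. (g x * f x - g x * p x)\<^sup>2)"
        using sq_integrable_square[OF sq[OF fp]] by (simp add: right_diff_distrib)
      show "integrable M (\<lambda>x. C\<^sup>2 * (f x - p x)\<^sup>2)" using sq_integrable_square[OF fp] by simp
      show "(g x * f x - g x * p x)\<^sup>2 \<le> C\<^sup>2 * (f x - p x)\<^sup>2" for x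
        using bd[of x "f x - p x"]
        by (simp add: right_diff_distrib[symmetric] power_mult_distrib[symmetric] abs_le_square_iff)
    qed
    also have "\<dots> \<le> (C\<^sup>2 + 1) * (\<integral>x. (f x - p x)\<^sup>2 \<partial>M)"
      by (simp add: mult_right_mono)
    also have "\<dots> < \<epsilon>"
      using p(2) by (simp add: pos_less_divide_eq add_nonneg_pos mult.commute)
    finally show "\<exists>h\<in>l2_closure M V. (\<integral>x. (g x * f x - h x)\<^sup>2 \<partial>M) < \<epsilon>"
      using V[OF p(1)] by (intro bexI[of _ "\<lambda>x. g x * p x"]) auto
  qed
qed (use assms in auto)

section \<open>The \<sigma>-algebra of sets whose indicators are multipliers\<close>

definition multiplier_sets :: "'a set set" where
  "multiplier_sets = {B. multiplier (indicat_real B)}"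

text \<open>Complements correspond to \<open>1 - g\<close> and intersections to products. Finite
  unions follow by De Morgan, and a countable union is the bounded pointwise limit of its finite
  partial unions.\<close>

lemma sigma_algebra_multiplier_sets: "sigma_algebra UNIV multiplier_sets"
proof (rule sigma_algebra_iff2[THEN iffD2], intro conjI ballI allI impI)
  show "{} \<in> multiplier_sets"
    using multiplier_const[of 0] by (simp add: multiplier_sets_def indicator_def[abs_def])
  have compl: "UNIV - B \<in> multiplier_sets" if "B \<in> multiplier_sets" for B
  proof -
    have "indicat_real (UNIV - B) = (\<lambda>x. 1 - indicat_real B x)" by (auto simp: indicator_def)
    then show ?thesis
      using multiplier_diff[OF multiplier_const that[unfolded multiplier_sets_def mem_Collect_eq]]
      by (simp add: multiplier_sets_def)
  qed
  then show "UNIV - B \<in> multiplier_sets" if "B \<in> multiplier_sets" for B using that .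
  have int: "A \<inter> B \<in> multiplier_sets" if "A \<in> multiplier_sets" "B \<in> multiplier_sets" for A B
  proof -
    have "indicat_real (A \<inter> B) = (\<lambda>x. indicat_real A x * indicat_real B x)"
      by (auto simp: indicator_def)
    then show ?thesis using multiplier_mult that by (simp add: multiplier_sets_def)
  qed
  fix A :: "nat \<Rightarrow> 'a set" assume "range A \<subseteq> multiplier_sets"
  then have fin: "(\<Union>i<n. A i) \<in> multiplier_sets" for n
  proof (induction n)
    case 0
    then show ?case using multiplier_const[of 0] by (simp add: multiplier_sets_def indicator_def[abs_def])
  next
    case (Suc n)
    have "(\<Union>i<Suc n. A i) = UNIV - ((UNIV - (\<Union>i<n. A i)) \<inter> (UNIV - A n))"
      by (auto simp: less_Suc_eq)
    then show ?case using Suc compl int by (metis range_subsetD)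
  qed
  have "multiplier (indicat_real (\<Union>i. A i))"
  proof (rule multiplier_limit)
    show "multiplier (indicat_real (\<Union>i<n. A i))" for n
      using fin by (simp add: multiplier_sets_def)
    show "\<bar>indicat_real (\<Union>i<n. A i) x\<bar> \<le> 1" for n x by (simp add: indicator_def)
    show "(\<lambda>n. indicat_real (\<Union>i<n. A i) x) \<longlonglongrightarrow> indicat_real (\<Union>i. A i) x" for x
      by (rule LIMSEQ_indicator_UN)
  qed
  then show "(\<Union>i. A i) \<in> multiplier_sets" by (simp add: multiplier_sets_def)
qed auto

text \<open>
  Continuous cutoffs converging to the indicator of a half line are approximated by polynomials
  on the range of \<open>g\<close>.
\<close>

lemma multiplier_sets_greater:
  assumes "multiplier g"
  shows "{x. c < g x} \<in> multiplier_sets"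
proof -
  obtain C where C: "\<And>x. \<bar>g x\<bar> \<le> C" using assms by (auto simp: multiplier_def)
  \<comment> \<open>For positive \<open>n\<close> a ramp: 0 up to \<open>c\<close>, then of slope
    \<open>n\<close>, and 1 from \<open>c + 1 / n\<close> on. Its limit is the indicator of the open
    half line, with value 0 at \<open>c\<close> itself.\<close>
  define h :: "nat \<Rightarrow> real \<Rightarrow> real" where "h n y = min 1 (max 0 (real n * (y - c)))" for n y
  have "\<exists>p. real_polynomial_function p \<and> (\<forall>y\<in>{-C..C}. \<bar>h n y - p y\<bar> < inverse (real (Suc n)))"
    for n
  proof -
    \<comment> \<open>Boundedness of \<open>g\<close> confines its values to a compact interval,
      where Weierstrass approximation is available.\<close>
    have "continuous_on {-C..C} (h n)" unfolding h_def by (intro continuous_intros)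
    from Stone_Weierstrass_real_polynomial_function[OF compact_Icc this, of "inverse (real (Suc n))"]
    show ?thesis by (metis inverse_positive_iff_positive of_nat_0_less_iff zero_less_Suc)
  qed
  then obtain p where p: "\<And>n. real_polynomial_function (p n)"
    "\<And>n y. y \<in> {-C..C} \<Longrightarrow> \<bar>h n y - p n y\<bar> < inverse (real (Suc n))"
    by metis
  have near: "\<bar>h n (g x) - p n (g x)\<bar> < inverse (real (Suc n))" for n x
    using C[of x] by (intro p(2)) (auto simp: abs_le_iff)
  have "multiplier (indicat_real {x. c < g x})"
  proof (rule multiplier_limit)
    show "multiplier (\<lambda>x. p n (g x))" for n by (rule multiplier_polynomial[OF p(1) assms])
    \<comment> \<open>At most 1 from the ramp and at most 1 from the approximation error; the bound
      is uniform in \<open>n\<close>, as \<open>multiplier_limit\<close> demands.\<close>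
    show "\<bar>p n (g x)\<bar> \<le> 2" for n x
    proof -
      have "inverse (real (Suc n)) \<le> 1" by (simp add: inverse_le_1_iff)
      moreover have "0 \<le> h n (g x)" "h n (g x) \<le> 1" by (auto simp: h_def)
      ultimately show ?thesis using near[of n x] by linarith
    qed
    show "(\<lambda>n. p n (g x)) \<longlonglongrightarrow> indicat_real {x. c < g x} x" for x
    proof -
      have h_lim: "(\<lambda>n. h n (g x)) \<longlonglongrightarrow> indicat_real {x. c < g x} x"
      proof (cases "c < g x")
        case True
        obtain N :: nat where N: "1 < real N * (g x - c)"
          using ex_less_of_nat_mult[of "g x - c" 1] True by auto
        have "h n (g x) = 1" if "n \<ge> N" for n
        proof -
          have "real N * (g x - c) \<le> real n * (g x - c)"
            using that True by (intro mult_right_mono) auto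
          then show ?thesis using N by (simp add: h_def)
        qed
        then have "eventually (\<lambda>n. h n (g x) = 1) sequentially"
          by (auto simp: eventually_sequentially)
        then show ?thesis using True by (simp add: tendsto_eventually)
      next
        case False
        then have "h n (g x) = 0" for n
          by (simp add: h_def mult_nonneg_nonpos)
        then show ?thesis using False by simp
      qed
      have "(\<lambda>n. h n (g x) - p n (g x)) \<longlonglongrightarrow> 0"
        by (rule Lim_null_comparison[OF _ LIMSEQ_inverse_real_of_nat])
           (use near in \<open>auto intro!: always_eventually less_imp_le\<close>)
      from tendsto_diff[OF h_lim this] show ?thesis by simp
    qed
  qed
  then show ?thesis by (simp add: multiplier_sets_def)
qed

end

section \<open>Measures with exponential moments\<close>

text \<open>A single term of the exponential series, all of whose terms are nonnegative here, is at
  most the sum.\<close>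

lemma power_le_fact_exp:
  fixes t :: real
  assumes "t \<ge> 0"
  shows "t ^ k \<le> fact k * exp t"
proof -
  have "(\<Sum>n\<in>{k}. t ^ n /\<^sub>R fact n) \<le> (\<Sum>n. t ^ n /\<^sub>R fact n)"
    by (rule sum_le_suminf) (use assms summable_exp_generic[of t] in auto)
  then show ?thesis by (simp add: exp_def field_simps)
qed

text \<open>Each sine coefficient is at most \<open>1 / fact i\<close> in absolute value. The bound
  is independent of \<open>n\<close> and so provides the dominating function for the Taylor
  polynomials.\<close>

lemma sin_partial_sum_le: "\<bar>\<Sum>i<n. sin_coeff i * y ^ i\<bar> \<le> exp \<bar>y\<bar>" for y :: real
proof -
  have "\<bar>\<Sum>i<n. sin_coeff i * y ^ i\<bar> \<le> (\<Sum>i<n. \<bar>y\<bar> ^ i /\<^sub>R fact i)"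
    by (rule order_trans[OF sum_abs sum_mono])
       (auto simp: sin_coeff_def abs_mult power_abs field_simps)
  also have "\<dots> \<le> (\<Sum>i. \<bar>y\<bar> ^ i /\<^sub>R fact i)"
    by (rule sum_le_suminf) (use summable_exp_generic[of "\<bar>y\<bar>"] in auto)
  finally show ?thesis by (simp add: exp_def)
qed

lemma integrable_power_exp:
  fixes M :: "real measure"
  assumes M: "sets M = sets borel" and int: "integrable M (\<lambda>x. exp (\<delta> * \<bar>x\<bar>))" and s: "s < \<delta>"
  shows "integrable M (\<lambda>x. x ^ k * exp (s * \<bar>x\<bar>))"
proof -
  have [measurable_cong]: "sets M = sets borel" by (fact M)
  have bound: "\<bar>x ^ k * exp (s * \<bar>x\<bar>)\<bar> \<le> fact k / (\<delta> - s) ^ k * exp (\<delta> * \<bar>x\<bar>)" for x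
  proof -
    \<comment> \<open>The surplus \<open>\<delta> - s\<close> in the exponent absorbs the power of
      \<open>x\<close>.\<close>
    have "(\<delta> - s) ^ k * \<bar>x\<bar> ^ k \<le> fact k * exp ((\<delta> - s) * \<bar>x\<bar>)"
      using power_le_fact_exp[of "(\<delta> - s) * \<bar>x\<bar>" k] s by (simp add: power_mult_distrib)
    then have "(\<delta> - s) ^ k * \<bar>x\<bar> ^ k * exp (s * \<bar>x\<bar>) \<le> fact k * exp ((\<delta> - s) * \<bar>x\<bar>) * exp (s * \<bar>x\<bar>)"
      by (rule mult_right_mono) simp
    also have "\<dots> = fact k * exp (\<delta> * \<bar>x\<bar>)"
      by (simp add: mult.assoc exp_add[symmetric] algebra_simps)
    finally show ?thesis using s by (simp add: field_simps abs_mult power_abs)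
  qed
  show ?thesis
    by (rule Bochner_Integration.integrable_bound[where
          f = "\<lambda>x. fact k / (\<delta> - s) ^ k * exp (\<delta> * \<bar>x\<bar>)"])
       (use int bound s in \<open>auto intro!: always_eventually order_trans[OF bound]\<close>)
qed

text \<open>Squaring doubles the exponent, whence the condition
  \<open>2 * s < \<delta>\<close>.\<close>

lemma sq_integrable_power_exp:
  fixes M :: "real measure"
  assumes M: "sets M = sets borel" and int: "integrable M (\<lambda>x. exp (\<delta> * \<bar>x\<bar>))" and s: "2 * s < \<delta>"
  shows "(\<lambda>x. x ^ k * exp (s * \<bar>x\<bar>)) \<in> sq_integrable M"
proof -
  have [measurable_cong]: "sets M = sets borel" by (fact M)
  have "(x ^ k * exp (s * \<bar>x\<bar>))\<^sup>2 = x ^ (k * 2) * exp (2 * s * \<bar>x\<bar>)" for x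
    unfolding power_mult_distrib power_mult mult.assoc exp_double ..
  then have "integrable M (\<lambda>x. (x ^ k * exp (s * \<bar>x\<bar>))\<^sup>2)"
    using integrable_power_exp[OF M int s, of "k * 2"] by simp
  then show ?thesis by (simp add: sq_integrable_def)
qed

lemma sq_integrable_poly:
  fixes M :: "real measure"
  assumes "sets M = sets borel" "integrable M (\<lambda>x. exp (\<delta> * \<bar>x\<bar>))" "0 < \<delta>"
  shows "poly q \<in> sq_integrable M"
proof -
  have "(\<lambda>x. \<Sum>k\<le>degree q. coeff q k * x ^ k) \<in> sq_integrable M"
    using sq_integrable_power_exp[OF assms(1,2), of 0] assms(3)
    by (intro sq_integrable_sum sq_integrable_scale) simp
  then show ?thesis by (simp add: poly_altdef[abs_def])
qed

text \<open>Monomials are required only in the closure of \<open>V\<close>: an omitted monomial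
  agrees with a combination of earlier ones just almost everywhere, so as a function it may lie
  outside the span. Elements of \<open>V\<close> are genuine polynomials, so that products with them
  reduce to products with monomials.\<close>

locale l2_polynomials = l2_subspace M V for M :: "real measure" and V +
  fixes \<delta> :: real
  assumes sets_M: "sets M = sets borel"
    and \<delta>_pos: "\<delta> > 0"
    and exp_moment: "integrable M (\<lambda>x. exp (\<delta> * \<bar>x\<bar>))"
    and V_poly: "p \<in> V \<Longrightarrow> \<exists>q. p = poly q"
    and monomial: "(\<lambda>x. x ^ k) \<in> l2_closure M V"
begin

declare sets_M[measurable_cong]

text \<open>
  For small \<open>t\<close> the Taylor series of \<open>sin (t x)\<close> times a monomial converges in mean square, being
  dominated by the monomial times \<open>exp (t \<bar>x\<bar>)\<close>.
\<close>

lemma multiplier_sin: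
  assumes t: "0 \<le> t" "2 * t < \<delta>"
  shows "multiplier (\<lambda>x. sin (t * x))"
proof (rule multiplierI)
  have mono: "(\<lambda>x. sin (t * x) * x ^ k) \<in> l2_closure M V" for k
  proof (rule closure_limit)
    show "(\<lambda>x. \<Sum>i<n. (sin_coeff i * t ^ i) * x ^ (i + k)) \<in> l2_closure M V" for n
      by (intro closure_sum closure_scale monomial)
    show "(\<lambda>x. x ^ k * exp (t * \<bar>x\<bar>)) \<in> sq_integrable M"
      by (rule sq_integrable_power_exp[OF sets_M exp_moment t(2)])
    have eq: "(\<Sum>i<n. (sin_coeff i * t ^ i) * x ^ (i + k)) = (\<Sum>i<n. sin_coeff i * (t * x) ^ i) * x ^ k"
      for n x
      by (simp add: sum_distrib_right power_add power_mult_distrib mult.assoc)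
    show "\<bar>\<Sum>i<n. (sin_coeff i * t ^ i) * x ^ (i + k)\<bar> \<le> \<bar>x ^ k * exp (t * \<bar>x\<bar>)\<bar>" for n x
    proof -
      have "\<bar>\<Sum>i<n. sin_coeff i * (t * x) ^ i\<bar> \<le> exp (t * \<bar>x\<bar>)"
        using sin_partial_sum_le[of "t * x" n] t(1) by (simp add: abs_mult)
      from mult_right_mono[OF this abs_ge_zero[of "x ^ k"]] show ?thesis
        unfolding eq abs_mult abs_exp_cancel mult.commute[of "\<bar>x ^ k\<bar>"] .
    qed
    show "(\<lambda>n. \<Sum>i<n. (sin_coeff i * t ^ i) * x ^ (i + k)) \<longlonglongrightarrow> sin (t * x) * x ^ k" for x
      unfolding eq using sin_converges[of "t * x"]
      by (intro tendsto_mult tendsto_const) (simp add: sums_def)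
  qed
  show "(\<lambda>x. sin (t * x) * p x) \<in> l2_closure M V" if p: "p \<in> V" for p
  proof -
    obtain q where q: "p = poly q" using V_poly[OF p] by blast
    have "(\<lambda>x. \<Sum>k\<le>degree q. coeff q k * (sin (t * x) * x ^ k)) \<in> l2_closure M V"
      by (intro closure_sum closure_scale mono)
    then show ?thesis by (simp add: q poly_altdef sum_distrib_left mult.left_commute)
  qed
  show "\<bar>sin (t * x)\<bar> \<le> 1" for x by simp
qed measurable

text \<open>The claim is that the identity is measurable from the space carrying
  \<open>multiplier_sets\<close> to the Borel space. Passing to the limit with measurability,
  instead of with multipliers, gets around the unboundedness of the identity.\<close>

lemma borel_subset_multiplier_sets:
  assumes B: "B \<in> sets borel"
  shows "B \<in> multiplier_sets"
proof -
  interpret S: sigma_algebra UNIV multiplier_sets by (rule sigma_algebra_multiplier_sets)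
  \<comment> \<open>Only the \<sigma>-algebra of \<open>N\<close> matters; its measure is taken to
    be zero.\<close>
  define N where "N = measure_of UNIV multiplier_sets (\<lambda>_. 0)"
  have N: "sets N = multiplier_sets" "space N = UNIV"
    by (simp_all add: N_def S.sets_measure_of_eq)
  \<comment> \<open>A null sequence of nonzero numbers; the factor 1/3 ensures
    \<open>2 * t n < \<delta>\<close>, as \<open>multiplier_sin\<close> requires.\<close>
  define t where "t n = \<delta> / 3 * inverse (real (Suc n))" for n
  have t: "0 < t n" "2 * t n < \<delta>" for n
  proof -
    show "0 < t n" using \<delta>_pos by (simp add: t_def)
    have "t n \<le> \<delta> / 3 * 1" unfolding t_def
      using \<delta>_pos by (intro mult_left_mono) (auto simp: inverse_le_1_iff)
    then show "2 * t n < \<delta>" using \<delta>_pos by simp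
  qed
  have t0: "filterlim t (at 0) sequentially"
    unfolding filterlim_at
  proof
    show "t \<longlonglongrightarrow> 0"
      unfolding t_def by (rule tendsto_eq_intros LIMSEQ_inverse_real_of_nat refl)+ simp
    show "\<forall>\<^sub>F n in sequentially. t n \<in> UNIV \<and> t n \<noteq> 0"
      using t(1) by (auto intro!: always_eventually simp: less_imp_neq[symmetric])
  qed
  have sin_meas: "(\<lambda>x. sin (t n * x)) \<in> borel_measurable N" for n
    by (rule borel_measurable_iff_greater[THEN iffD2])
       (use multiplier_sets_greater[OF multiplier_sin] t[of n] in \<open>simp add: N less_imp_le\<close>)
  have "(\<lambda>x. x) \<in> borel_measurable N"
  proof (rule borel_measurable_LIMSEQ_real)
    show "(\<lambda>x. sin (t n * x) / t n) \<in> borel_measurable N" for n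
      using sin_meas by measurable
    fix x :: real
    \<comment> \<open>Since \<open>sin 0 = 0\<close>, the quotient \<open>sin (h * x) / h\<close> is
      the difference quotient of this function at 0.\<close>
    have "((\<lambda>h. sin (h * x)) has_field_derivative x) (at 0)"
      by (auto intro!: derivative_eq_intros)
    then have "((\<lambda>h. sin (h * x) / h) \<longlongrightarrow> x) (at 0)"
      by (simp add: DERIV_def)
    from filterlim_compose[OF this t0] show "(\<lambda>n. sin (t n * x) / t n) \<longlonglongrightarrow> x" .
  qed
  from measurable_sets[OF this B] show ?thesis by (simp add: N)
qed

theorem l2_closure_eq: "l2_closure M V = sq_integrable M"
proof (intro equalityI closure_subset subsetI)
  fix f assume f: "f \<in> sq_integrable M"
  have one: "(\<lambda>x. 1) \<in> l2_closure M V" using monomial[of 0] by simp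
  \<comment> \<open>An indicator is the product of itself, a multiplier, with the constant
    1.\<close>
  have ind: "indicat_real B \<in> l2_closure M V" if "B \<in> sets borel" for B
    using multiplierD[OF _ one] borel_subset_multiplier_sets[OF that]
    by (simp add: multiplier_sets_def)
  \<comment> \<open>The bound by twice the distance of \<open>f x\<close> from 0 makes
    \<open>2 * f x\<close> a dominating function for \<open>closure_limit\<close>.\<close>
  obtain F where F: "\<And>i. simple_function M (F i)" "\<And>x. (\<lambda>i. F i x) \<longlonglongrightarrow> f x"
    "\<And>i x. dist (F i x) 0 \<le> 2 * dist (f x) 0"
    using borel_measurable_implies_sequence_metric[OF sq_integrable_measurable[OF f], of 0]
    by (auto simp: sets_eq_imp_space_eq[OF sets_M])
  show "f \<in> l2_closure M V"
  proof (rule closure_limit)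
    show "F i \<in> l2_closure M V" for i
    proof -
      have "(\<lambda>x. \<Sum>y\<in>range (F i). y * indicat_real (F i -` {y}) x) \<in> l2_closure M V"
      proof (intro closure_sum closure_scale ind)
        show "F i -` {y} \<in> sets borel" for y
          using simple_functionD(2)[OF F(1), of i "{y}"]
          by (simp add: sets_M sets_eq_imp_space_eq[OF sets_M])
      qed
      also have "(\<lambda>x. \<Sum>y\<in>range (F i). y * indicat_real (F i -` {y}) x) = F i"
      proof
        fix x
        have fin: "finite (range (F i))"
          using simple_functionD(1)[OF F(1), of i] by (simp add: sets_eq_imp_space_eq[OF sets_M])
        have "(\<Sum>y\<in>range (F i). y * indicat_real (F i -` {y}) x)
            = (\<Sum>y\<in>range (F i). if y = F i x then y else 0)"
          by (intro sum.cong) (auto simp: indicator_def)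
        then show "(\<Sum>y\<in>range (F i). y * indicat_real (F i -` {y}) x) = F i x"
          using fin by simp
      qed
      finally show ?thesis .
    qed
    show "(\<lambda>x. 2 * f x) \<in> sq_integrable M" by (rule sq_integrable_scale[OF f])
    show "\<bar>F i x\<bar> \<le> \<bar>2 * f x\<bar>" for i x using F(3)[of i x] by (simp add: abs_mult)
  qed (rule F(2))
qed

end

section \<open>The orthonormal polynomials\<close>

lemma l2_subspace_family_span:
  assumes "\<And>i. i \<in> I \<Longrightarrow> e i \<in> sq_integrable M"
  shows "l2_subspace M (family_span I e)"
proof
  show "family_span I e \<subseteq> sq_integrable M"
    using assms by (auto simp: family_span_def intro!: sq_integrable_sum sq_integrable_scale)
  show "(\<lambda>x. 0) \<in> family_span I e"
    by (auto simp: family_span_def intro!: exI[of _ "{}"])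
  fix f g and d :: real
  assume "f \<in> family_span I e"
  then obtain F c where F: "finite F" "F \<subseteq> I" "f = (\<lambda>x. \<Sum>i\<in>F. c i * e i x)"
    by (auto simp: family_span_def)
  then show "(\<lambda>x. d * f x) \<in> family_span I e"
    unfolding family_span_def
    by (auto simp: sum_distrib_left mult.assoc intro!: exI[of _ F] exI[of _ "\<lambda>i. d * c i"])
  assume "g \<in> family_span I e"
  then obtain G b where G: "finite G" "G \<subseteq> I" "g = (\<lambda>x. \<Sum>i\<in>G. b i * e i x)"
    by (auto simp: family_span_def)
  \<comment> \<open>Both combinations are extended by zero coefficients to the common index set
    \<open>F \<union> G\<close>.\<close>
  define c' where "c' i = (if i \<in> F then c i else 0)" for i
  define b' where "b' i = (if i \<in> G then b i else 0)" for i
  have "f x = (\<Sum>i\<in>F \<union> G. c' i * e i x)" "g x = (\<Sum>i\<in>F \<union> G. b' i * e i x)" for x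
    unfolding F(3) G(3) using F(1) G(1)
    by (auto simp: c'_def b'_def intro!: sum.mono_neutral_cong_left)
  then have "(\<lambda>x. f x + g x) = (\<lambda>x. \<Sum>i\<in>F \<union> G. (c' i + b' i) * e i x)"
    by (simp add: sum.distrib distrib_right)
  then show "(\<lambda>x. f x + g x) \<in> family_span I e"
    using F G unfolding family_span_def by (auto intro!: exI[of _ "F \<union> G"] exI[of _ "\<lambda>i. c' i + b' i"])
qed

locale exp_weight =
  fixes \<nu> :: "real measure" and a :: "real \<Rightarrow> real" and \<delta> :: real
  assumes sets_\<nu>: "sets \<nu> = sets borel"
    and a_borel: "a \<in> borel_measurable borel"
    and a_nonneg: "a x \<ge> 0"
    and \<delta>_pos: "\<delta> > 0"
    and moment_gen_finite: "moment_gen \<nu> a \<delta> < \<infinity>" "moment_gen \<nu> a (- \<delta>) < \<infinity>"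
begin

section \<open>Translation from the weighted space to square integrable functions\<close>

abbreviation "\<mu> \<equiv> weighted_measure \<nu> a"

lemma sets_\<mu>: "sets \<mu> = sets borel"
  by (simp add: weighted_measure_def sets_\<nu>)

declare sets_\<nu>[measurable_cong] sets_\<mu>[measurable_cong] a_borel[measurable]

lemma borel_measurable_\<mu>: "f \<in> borel_measurable \<mu> \<longleftrightarrow> f \<in> borel_measurable borel" for f :: "real \<Rightarrow> real"
  by (rule arg_cong[where f = "\<lambda>S. f \<in> S"]) (rule measurable_cong_sets[OF sets_\<mu> refl])

lemma weighted_L2_eq: "weighted_L2 \<nu> a = sq_integrable \<mu>"
  by (simp add: weighted_L2_def sq_integrable_def borel_measurable_\<mu>)

lemma weighted_inner_eq:
  assumes "f \<in> borel_measurable borel" "g \<in> borel_measurable borel"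
  shows "weighted_inner \<nu> a f g = (\<integral>x. f x * g x \<partial>\<mu>)"
  unfolding weighted_inner_def weighted_measure_def using assms a_nonneg
  by (subst integral_density) (auto simp: mult.commute)

lemma weighted_norm_eq:
  assumes "f \<in> borel_measurable borel"
  shows "weighted_norm \<nu> a f = sqrt (\<integral>x. (f x)\<^sup>2 \<partial>\<mu>)"
  using assms by (simp add: weighted_norm_def weighted_inner_eq power2_eq_square)

text \<open>The sum of the exponentials at the endpoints \<open>\<delta>\<close> and
  \<open>- \<delta>\<close> dominates \<open>exp (\<delta> * \<bar>x\<bar>)\<close>.\<close>

lemma exp_moment: "integrable \<mu> (\<lambda>x. exp (\<delta> * \<bar>x\<bar>))"
proof -
  have exp_int: "integrable \<mu> (\<lambda>x. exp (s * x))" if "moment_gen \<nu> a s < \<infinity>" for s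
  proof (rule integrableI_bounded)
    have "(\<integral>\<^sup>+x. ennreal (norm (exp (s * x))) \<partial>\<mu>) = moment_gen \<nu> a s"
      unfolding weighted_measure_def moment_gen_def using a_nonneg
      by (subst nn_integral_density) (auto simp: ennreal_mult' mult.commute)
    with that show "(\<integral>\<^sup>+x. ennreal (norm (exp (s * x))) \<partial>\<mu>) < \<infinity>" by simp
  qed measurable
  show ?thesis
  proof (rule Bochner_Integration.integrable_bound)
    show "integrable \<mu> (\<lambda>x. exp (\<delta> * x) + exp (- \<delta> * x))"
      using exp_int moment_gen_finite by (intro Bochner_Integration.integrable_add)
    have "norm (exp (\<delta> * \<bar>x\<bar>)) \<le> norm (exp (\<delta> * x) + exp (- \<delta> * x))" for x
      using abs_of_pos[OF add_pos_pos[OF exp_gt_zero exp_gt_zero], of "\<delta> * x" "- \<delta> * x"]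
      by (cases "x \<ge> 0") auto
    then show "AE x in \<mu>. norm (exp (\<delta> * \<bar>x\<bar>)) \<le> norm (exp (\<delta> * x) + exp (- \<delta> * x))"
      by simp
  qed measurable
qed

lemma poly_sq_integrable: "poly q \<in> sq_integrable \<mu>"
  by (rule sq_integrable_poly[OF sets_\<mu> exp_moment \<delta>_pos])

section \<open>The Gram-Schmidt recursion and orthonormality\<close>

definition gs_residual :: "nat \<Rightarrow> real \<Rightarrow> real" where
  "gs_residual n x = x ^ n - (\<Sum>k \<in> {k \<in> gs_index \<nu> a. k < n}.
     weighted_inner \<nu> a (\<lambda>y. y ^ n) (gs_poly \<nu> a k) * gs_poly \<nu> a k x)"

lemma gs_poly_eq: "gs_poly \<nu> a n = (\<lambda>x. gs_residual n x / weighted_norm \<nu> a (gs_residual n))"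
  by (subst gs_poly.simps) (simp add: gs_residual_def[abs_def] Let_def)

text \<open>The premise covers only \<open>k < n\<close>, so that the lemma can be used inside the
  strong induction of \<open>gs_poly_poly\<close>. Vanishing coefficients from \<open>n\<close> on
  express that \<open>q\<close> has degree below \<open>n\<close>, with \<open>q = 0\<close> when
  \<open>n = 0\<close>.\<close>

lemma gs_residual_polyI:
  assumes "\<And>k. k < n \<Longrightarrow> \<exists>q. gs_poly \<nu> a k = poly q \<and> (\<forall>j>k. coeff q j = 0)"
  shows "\<exists>q. gs_residual n = poly (monom 1 n - q) \<and> (\<forall>j\<ge>n. coeff q j = 0)"
proof -
  obtain Q where Q: "\<And>k. k < n \<Longrightarrow> gs_poly \<nu> a k = poly (Q k)"
    "\<And>k j. k < n \<Longrightarrow> k < j \<Longrightarrow> coeff (Q k) j = 0"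
    using assms by metis
  define q where "q = (\<Sum>k \<in> {k \<in> gs_index \<nu> a. k < n}.
    smult (weighted_inner \<nu> a (\<lambda>y. y ^ n) (gs_poly \<nu> a k)) (Q k))"
  have "gs_residual n = poly (monom 1 n - q)"
    by (rule ext) (auto simp: gs_residual_def q_def poly_monom poly_sum Q(1) intro!: sum.cong)
  moreover have "\<forall>j\<ge>n. coeff q j = 0"
    by (auto simp: q_def coeff_sum Q(2) intro!: sum.neutral)
  ultimately show ?thesis by blast
qed

lemma gs_poly_poly: "\<exists>q. gs_poly \<nu> a n = poly q \<and> (\<forall>j>n. coeff q j = 0)"
proof (induction n rule: less_induct)
  case (less n)
  obtain q where q: "gs_residual n = poly (monom 1 n - q)" "\<forall>j\<ge>n. coeff q j = 0"
    using gs_residual_polyI[OF less.IH] by blast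
  \<comment> \<open>Omitted exponents are included: should the norm vanish, division by 0 gives 0
    and both sides are the zero function.\<close>
  let ?p = "smult (1 / weighted_norm \<nu> a (gs_residual n)) (monom 1 n - q)"
  have "gs_poly \<nu> a n = poly ?p"
    by (rule ext) (simp add: gs_poly_eq q(1))
  moreover have "\<forall>j>n. coeff ?p j = 0" using q(2) by simp
  ultimately show ?case by blast
qed

lemma gs_residual_poly:
  "\<exists>q. gs_residual n = poly (monom 1 n - q) \<and> (\<forall>j\<ge>n. coeff q j = 0)"
  by (rule gs_residual_polyI[OF gs_poly_poly])

lemma gs_poly_sq_integrable: "gs_poly \<nu> a n \<in> sq_integrable \<mu>"
  using gs_poly_poly[of n] poly_sq_integrable by auto

lemma gs_residual_sq_integrable: "gs_residual n \<in> sq_integrable \<mu>"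
  using gs_residual_poly[of n] poly_sq_integrable by auto

lemma gs_poly_borel: "gs_poly \<nu> a n \<in> borel_measurable borel"
  using gs_poly_sq_integrable sq_integrable_measurable borel_measurable_\<mu> by blast

lemma gs_residual_borel: "gs_residual n \<in> borel_measurable borel"
  using gs_residual_sq_integrable sq_integrable_measurable borel_measurable_\<mu> by blast

lemma power_sq_integrable: "(\<lambda>x. x ^ n) \<in> sq_integrable \<mu>"
  using poly_sq_integrable[of "monom 1 n"] by (simp add: poly_monom[abs_def])

text \<open>If the norm vanished, the residual would be zero almost everywhere, and since it is the
  monomial minus a polynomial of lower degree, the monomial would be dependent on its
  predecessors.\<close>

lemma gs_residual_norm_pos:
  assumes "n \<in> gs_index \<nu> a"
  shows "weighted_norm \<nu> a (gs_residual n) > 0"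
proof (rule ccontr)
  assume "\<not> weighted_norm \<nu> a (gs_residual n) > 0"
  then have "(\<integral>x. (gs_residual n x)\<^sup>2 \<partial>\<mu>) \<le> 0"
    by (simp add: weighted_norm_eq[OF gs_residual_borel])
  then have "(\<integral>x. (gs_residual n x)\<^sup>2 \<partial>\<mu>) = 0"
    by (intro antisym integral_nonneg_AE) auto
  then have zero: "AE x in \<mu>. gs_residual n x = 0"
    using integral_nonneg_eq_0_iff_AE[OF sq_integrable_square[OF gs_residual_sq_integrable]] by simp
  obtain q where q: "gs_residual n = poly (monom 1 n - q)" "\<forall>j\<ge>n. coeff q j = 0"
    using gs_residual_poly by blast
  have "poly q x = (\<Sum>k<n. coeff q k * x ^ k)" for x
    unfolding poly_altdef using q(2) le_degree[of q]
    by (intro sum.mono_neutral_cong) (auto simp: not_less not_le coeff_eq_0)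
  with zero have "AE x in \<mu>. x ^ n = (\<Sum>k<n. coeff q k * x ^ k)"
    by (simp add: q(1) poly_monom)
  then show False using assms by (auto simp: gs_index_def monomial_dependent_def)
qed

lemma weighted_inner_commute: "weighted_inner \<nu> a f g = weighted_inner \<nu> a g f"
  by (simp add: weighted_inner_def mult.commute)

lemma gs_poly_orthonormal:
  assumes "i \<in> gs_index \<nu> a" "j \<in> gs_index \<nu> a"
  shows "weighted_inner \<nu> a (gs_poly \<nu> a i) (gs_poly \<nu> a j) = (if i = j then 1 else 0)"
proof -
  let ?e = "gs_poly \<nu> a" and ?I = "gs_index \<nu> a"
  \<comment> \<open>Induction on a common strict bound: the hypothesis then covers all pairs of
    earlier indices, and only pairs involving \<open>n\<close> are new.\<close>
  have "\<forall>i\<in>?I. \<forall>j\<in>?I. i < n \<longrightarrow> j < n \<longrightarrow>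
    weighted_inner \<nu> a (?e i) (?e j) = (if i = j then 1 else 0)" for n
  proof (induction n)
    case (Suc n)
    let ?N = "weighted_norm \<nu> a (gs_residual n)"
    have new: "weighted_inner \<nu> a (?e n) (?e n) = 1" if "n \<in> ?I"
    proof -
      have "weighted_inner \<nu> a (?e n) (?e n) = (\<integral>x. (gs_residual n x)\<^sup>2 \<partial>\<mu>) / ?N\<^sup>2"
        by (subst weighted_inner_eq[OF gs_poly_borel gs_poly_borel])
           (simp add: gs_poly_eq power2_eq_square)
      also have "(\<integral>x. (gs_residual n x)\<^sup>2 \<partial>\<mu>) = ?N\<^sup>2"
        by (simp add: weighted_norm_eq[OF gs_residual_borel] integral_nonneg_AE)
      finally show ?thesis using gs_residual_norm_pos[OF that] by simp
    qed
    have old: "weighted_inner \<nu> a (?e n) (?e j) = 0" if j: "j \<in> ?I" "j < n" for j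
    proof -
      let ?K = "{k \<in> ?I. k < n}"
      let ?c = "\<lambda>k. weighted_inner \<nu> a (\<lambda>y. y ^ n) (?e k)"
      have int: "integrable \<mu> (\<lambda>x. ?c k * (?e k x * ?e j x))" for k
        using sq_integrable_mult[OF gs_poly_sq_integrable gs_poly_sq_integrable] by simp
      have int': "integrable \<mu> (\<lambda>x. x ^ n * ?e j x)"
        by (rule sq_integrable_mult[OF power_sq_integrable gs_poly_sq_integrable])
      have "(\<integral>x. gs_residual n x * ?e j x \<partial>\<mu>)
          = (\<integral>x. x ^ n * ?e j x - (\<Sum>k\<in>?K. ?c k * (?e k x * ?e j x)) \<partial>\<mu>)"
        by (simp add: gs_residual_def left_diff_distrib sum_distrib_right mult.assoc)
      also have "\<dots> = (\<integral>x. x ^ n * ?e j x \<partial>\<mu>) - (\<Sum>k\<in>?K. ?c k * (\<integral>x. ?e k x * ?e j x \<partial>\<mu>))"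
        using int int' by (simp add: Bochner_Integration.integral_diff Bochner_Integration.integral_sum)
      also have "\<dots> = ?c j - (\<Sum>k\<in>?K. ?c k * weighted_inner \<nu> a (?e k) (?e j))"
        by (simp add: weighted_inner_eq gs_poly_borel)
      \<comment> \<open>By orthonormality of the earlier polynomials only \<open>k = j\<close>
        survives, and its term cancels the inner product of the monomial with
        \<open>?e j\<close>.\<close>
      also have "(\<Sum>k\<in>?K. ?c k * weighted_inner \<nu> a (?e k) (?e j)) = (\<Sum>k\<in>?K. if k = j then ?c k else 0)"
        using Suc.IH j by (intro sum.cong) auto
      also have "\<dots> = ?c j" using j by simp
      finally show ?thesis
        by (subst weighted_inner_eq[OF gs_poly_borel gs_poly_borel])
           (subst gs_poly_eq, simp)
    qed
    show ?case
    proof (intro ballI impI)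
      fix i j assume ij: "i \<in> ?I" "j \<in> ?I" "i < Suc n" "j < Suc n"
      then consider "i < n" "j < n" | "i = n" "j = n" | "i = n" "j < n" | "i < n" "j = n"
        by linarith
      then show "weighted_inner \<nu> a (?e i) (?e j) = (if i = j then 1 else 0)"
      proof cases
        case 4
        then show ?thesis using old[of i] ij by (simp add: weighted_inner_commute[of "?e i"])
      qed (use ij Suc.IH new old in auto)
    qed
  qed simp
  from this[of "Suc (max i j)"] assms show ?thesis by simp
qed

section \<open>Completeness of the orthonormal polynomials\<close>

sublocale l2_subspace \<mu> "family_span (gs_index \<nu> a) (gs_poly \<nu> a)"
  by (rule l2_subspace_family_span[OF gs_poly_sq_integrable])

text \<open>For an index that is kept, solving the recursion for the monomial puts it into the span,
  as the norm of the residual is positive. An omitted monomial equals almost everywhere a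
  combination of lower ones, which are covered by induction.\<close>

lemma monomial_in_closure:
  "(\<lambda>x. x ^ n) \<in> l2_closure \<mu> (family_span (gs_index \<nu> a) (gs_poly \<nu> a))"
proof (induction n rule: less_induct)
  case (less n)
  show ?case
  proof (cases "n \<in> gs_index \<nu> a")
    case True
    have e: "gs_poly \<nu> a k \<in> l2_closure \<mu> (family_span (gs_index \<nu> a) (gs_poly \<nu> a))"
      if "k \<in> gs_index \<nu> a" for k
    proof -
      have "gs_poly \<nu> a k \<in> family_span (gs_index \<nu> a) (gs_poly \<nu> a)"
        unfolding family_span_def using that
        by (auto intro!: exI[of _ "{k}"] exI[of _ "\<lambda>_. 1"])
      then show ?thesis using subset_closure by blast
    qed
    have "(\<lambda>x. weighted_norm \<nu> a (gs_residual n) * gs_poly \<nu> a n x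
        + (\<Sum>k \<in> {k \<in> gs_index \<nu> a. k < n}.
            weighted_inner \<nu> a (\<lambda>y. y ^ n) (gs_poly \<nu> a k) * gs_poly \<nu> a k x))
      \<in> l2_closure \<mu> (family_span (gs_index \<nu> a) (gs_poly \<nu> a))"
      by (intro closure_add closure_sum closure_scale e) (use True in auto)
    also have "(\<lambda>x. weighted_norm \<nu> a (gs_residual n) * gs_poly \<nu> a n x
        + (\<Sum>k \<in> {k \<in> gs_index \<nu> a. k < n}.
            weighted_inner \<nu> a (\<lambda>y. y ^ n) (gs_poly \<nu> a k) * gs_poly \<nu> a k x)) = (\<lambda>x. x ^ n)"
    proof
      fix x
      have "weighted_norm \<nu> a (gs_residual n) * gs_poly \<nu> a n x = gs_residual n x"
        using gs_residual_norm_pos[OF True] by (subst gs_poly_eq) simp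
      then show "weighted_norm \<nu> a (gs_residual n) * gs_poly \<nu> a n x
        + (\<Sum>k \<in> {k \<in> gs_index \<nu> a. k < n}.
            weighted_inner \<nu> a (\<lambda>y. y ^ n) (gs_poly \<nu> a k) * gs_poly \<nu> a k x) = x ^ n"
        by (simp add: gs_residual_def)
    qed
    finally show ?thesis .
  next
    case False
    then obtain c :: "nat \<Rightarrow> real" where "AE x in \<mu>. x ^ n = (\<Sum>k<n. c k * x ^ k)"
      by (auto simp: gs_index_def monomial_dependent_def)
    then have eq: "AE x in \<mu>. (\<Sum>k<n. c k * x ^ k) = x ^ n" by (simp add: eq_commute)
    have "(\<lambda>x. \<Sum>k<n. c k * x ^ k) \<in> l2_closure \<mu> (family_span (gs_index \<nu> a) (gs_poly \<nu> a))"
      by (intro closure_sum closure_scale less.IH) simp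
    from closure_cong_AE[OF this _ eq] show ?thesis by simp
  qed
qed

sublocale l2_polynomials \<mu> "family_span (gs_index \<nu> a) (gs_poly \<nu> a)" \<delta>
proof
  fix p assume "p \<in> family_span (gs_index \<nu> a) (gs_poly \<nu> a)"
  then obtain F c where p: "p = (\<lambda>x. \<Sum>i\<in>F. c i * gs_poly \<nu> a i x)"
    by (auto simp: family_span_def)
  obtain Q where "\<And>k. gs_poly \<nu> a k = poly (Q k)" using gs_poly_poly by metis
  then have "p = poly (\<Sum>i\<in>F. smult (c i) (Q i))" by (auto simp: p poly_sum)
  then show "\<exists>q. p = poly q" by blast
qed (use sets_\<mu> \<delta>_pos exp_moment monomial_in_closure in auto)

text \<open>One closure uses the norm and the other its square; the tolerance \<epsilon> is matched
  with its square root in one direction and with its square in the other.\<close>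

lemma closed_family_span_eq:
  "closed_family_span \<nu> a (gs_index \<nu> a) (gs_poly \<nu> a) =
     l2_closure \<mu> (family_span (gs_index \<nu> a) (gs_poly \<nu> a))"
proof -
  have norm: "weighted_norm \<nu> a (\<lambda>x. f x - g x) = sqrt (\<integral>x. (f x - g x)\<^sup>2 \<partial>\<mu>)"
    if "f \<in> sq_integrable \<mu>" "g \<in> family_span (gs_index \<nu> a) (gs_poly \<nu> a)" for f g
  proof -
    have "(\<lambda>x. f x - g x) \<in> sq_integrable \<mu>"
      by (rule sq_integrable_diff) (use that subset in auto)
    then show ?thesis
      using weighted_norm_eq borel_measurable_\<mu> sq_integrable_measurable by auto
  qed
  have "(\<forall>\<epsilon>>0. \<exists>g\<in>family_span (gs_index \<nu> a) (gs_poly \<nu> a). weighted_norm \<nu> a (\<lambda>x. f x - g x) < \<epsilon>)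
    \<longleftrightarrow> (\<forall>\<epsilon>>0. \<exists>g\<in>family_span (gs_index \<nu> a) (gs_poly \<nu> a). (\<integral>x. (f x - g x)\<^sup>2 \<partial>\<mu>) < \<epsilon>)"
    (is "?L \<longleftrightarrow> ?R") if f: "f \<in> sq_integrable \<mu>" for f
  proof
    assume L: ?L
    show ?R
    proof (intro allI impI)
      fix \<epsilon> :: real assume "\<epsilon> > 0"
      then obtain g where "g \<in> family_span (gs_index \<nu> a) (gs_poly \<nu> a)"
        "weighted_norm \<nu> a (\<lambda>x. f x - g x) < sqrt \<epsilon>"
        using L by (meson real_sqrt_gt_zero)
      then show "\<exists>g\<in>family_span (gs_index \<nu> a) (gs_poly \<nu> a). (\<integral>x. (f x - g x)\<^sup>2 \<partial>\<mu>) < \<epsilon>"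
        using norm[OF f] by (intro bexI[of _ g]) auto
    qed
  next
    assume R: ?R
    show ?L
    proof (intro allI impI)
      fix \<epsilon> :: real assume \<epsilon>: "\<epsilon> > 0"
      then obtain g where "g \<in> family_span (gs_index \<nu> a) (gs_poly \<nu> a)"
        "(\<integral>x. (f x - g x)\<^sup>2 \<partial>\<mu>) < \<epsilon>\<^sup>2"
        using R by (meson zero_less_power)
      then show "\<exists>g\<in>family_span (gs_index \<nu> a) (gs_poly \<nu> a). weighted_norm \<nu> a (\<lambda>x. f x - g x) < \<epsilon>"
        using norm[OF f] \<epsilon> by (intro bexI[of _ g]) (auto intro: real_less_lsqrt)
    qed
  qed
  then show ?thesis
    unfolding closed_family_span_def l2_closure_def weighted_L2_eq
    by (intro Collect_cong conj_cong refl)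
qed

theorem complete_orthonormal_gs_poly: "complete_orthonormal \<nu> a (gs_index \<nu> a) (gs_poly \<nu> a)"
  unfolding complete_orthonormal_def orthonormal_family_def closed_family_span_eq weighted_L2_eq
  using gs_poly_orthonormal gs_poly_sq_integrable l2_closure_eq by auto

end

theorem theorem1:
  fixes \<nu> :: "real measure" and a :: "real \<Rightarrow> real"
  assumes "sigma_finite_measure \<nu>"
    and "sets \<nu> = sets borel"
    and "a \<in> borel_measurable borel"
    and "finite_measure (weighted_measure \<nu> a)"
    and "\<forall>x. a x > 0"
    and "\<exists>\<delta>>0. \<forall>s\<in>{-\<delta>..\<delta>}. moment_gen \<nu> a s < \<infinity>"
  shows "complete_orthonormal \<nu> a (gs_index \<nu> a) (gs_poly \<nu> a)"
proof -
  obtain \<delta> where \<delta>: "\<delta> > 0" "\<forall>s\<in>{-\<delta>..\<delta>}. moment_gen \<nu> a s < \<infinity>"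
    using assms(6) by blast
  \<comment> \<open>The interval contains both of its endpoints, where the locale asks for finite
    moments.\<close>
  interpret exp_weight \<nu> a \<delta>
    by unfold_locales (use assms(2,3,5) \<delta> in \<open>auto intro: less_imp_le\<close>)
  show ?thesis by (rule complete_orthonormal_gs_poly)
qed

end
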